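(* If the exponential family $\{\mathcal{P}_{A,\Theta}\}_{A\in\mathcal{A}}$ is projective, then the sufficient statistics $\{T_A\}_{A\in\mathcal{A}}$ have independent increments; that is, for all $A\subset B$ in $\mathcal{A}$ and all $\theta\in\Theta$, the random variables $T_B-T_A$ and $T_A$ are independent under $\mathbb{P}_{B,\theta}$.
   Context: Let $\mathbb{I}$ be a denumerable set and $\mathcal{A}$ a collection of finite subsets of $\mathbb{I}$, partially ordered by inclusion, which is an ideal: subsets of members of $\mathcal{A}$ and unions of two members of $\mathcal{A}$ belong to $\mathcal{A}$. To each $A\in\mathcal{A}$ is attached a countable set $\mathcal{X}_A$, in such a way that for $A\subset B$ in $\mathcal{A}$ one has $\mathcal{X}_B=\mathcal{X}_A\times\mathcal{X}_{B\setminus A}$; points of $\mathcal{X}_B$ are written $(x,y)$ with $x\in\mathcal{X}_A$, $y\in\mathcal{X}_{B\setminus A}$, and $\pi_{B\mapsto A}:\mathcal{X}_B\to\mathcal{X}_A$, $\pi_{B\mapsto A}(x,y)=x$, is the coordinate projection. Let $\Theta\subseteq\mathbb{R}^d$ be a fixed open set. For each $A\in\mathcal{A}$ let $t_A:\mathcal{X}_A\to\mathbb{R}^d$ be a function (the minimal sufficient statistic) such that $z_A(\theta)=\sum_{x\in\mathcal{X}_A}e^{\langle\theta,t_A(x)\rangle}$ is finite for every $\theta\in\Theta$, and let $\mathbb{P}_{A,\theta}$ be the probability distribution on $\mathcal{X}_A$ with mass function $p_{A,\theta}(x)=e^{\langle\theta,t_A(x)\rangle}/z_A(\theta)$. Put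 $\mathcal{P}_{A,\Theta}=\{\mathbb{P}_{A,\theta}\}_{\theta\in\Theta}$. The family $\{\mathcal{P}_{A,\Theta}\}_{A\in\mathcal{A}}$ is projective if for all $A\subset B$ in $\mathcal{A}$ and all $\theta\in\Theta$, $\mathbb{P}_{A,\theta}=\mathbb{P}_{B,\theta}\circ\pi_{B\mapsto A}^{-1}$. For $A\subset B$, write $X_B=(X_A,X_{B\setminus A})\sim\mathbb{P}_{B,\theta}$, so $X_A=\pi_{B\mapsto A}(X_B)$, and $T_B=t_B(X_B)$, $T_A=t_A(X_A)$. *)

theory Defs
  imports "HOL-Probability.Probability"
begin

text \<open>
  A literal equation \<open>X B = X A \<times> X (B - A)\<close> for all \<open>A \<subseteq> B\<close> does not typecheck, so
  \<open>X B\<close> is identified with the product through its two coordinate projections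
  \<open>\<pi> B A\<close> and \<open>\<pi> B (B - A)\<close>. The laws \<open>proj_id\<close> and \<open>proj_comp\<close> say that these
  identifications are compatible with each other (a standard instance is
  \<open>X A = (\<Pi>\<^sub>E i\<in>A. S i)\<close> with \<open>\<pi> B A x = restrict x A\<close>). They make \<open>X {}\<close>
  a one-point set.
\<close>

locale configuration_spaces =
  fixes I :: "'i set"
    and \<A> :: "'i set set"
    and X :: "'i set \<Rightarrow> 'x set"
    and \<pi> :: "'i set \<Rightarrow> 'i set \<Rightarrow> 'x \<Rightarrow> 'x"
  assumes denumerable: "countable I" "infinite I"
    and finite_subsets: "A \<in> \<A> \<Longrightarrow> finite A \<and> A \<subseteq> I"
    and ideal_subset: "B \<in> \<A> \<Longrightarrow> A \<subseteq> B \<Longrightarrow> A \<in> \<A>"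
    and ideal_union: "A \<in> \<A> \<Longrightarrow> B \<in> \<A> \<Longrightarrow> A \<union> B \<in> \<A>"
    and countable_X: "A \<in> \<A> \<Longrightarrow> countable (X A)"
    and nonempty_X: "A \<in> \<A> \<Longrightarrow> X A \<noteq> {}"
    and product: "B \<in> \<A> \<Longrightarrow> A \<subseteq> B \<Longrightarrow>
      bij_betw (\<lambda>w. (\<pi> B A w, \<pi> B (B - A) w)) (X B) (X A \<times> X (B - A))"
    and proj_id: "B \<in> \<A> \<Longrightarrow> w \<in> X B \<Longrightarrow> \<pi> B B w = w"
    and proj_comp: "C \<in> \<A> \<Longrightarrow> A \<subseteq> B \<Longrightarrow> B \<subseteq> C \<Longrightarrow> w \<in> X C \<Longrightarrow>
      \<pi> B A (\<pi> C B w) = \<pi> C A w"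

definition partition_function ::
    "'x set \<Rightarrow> ('x \<Rightarrow> real ^ 'd) \<Rightarrow> real ^ 'd \<Rightarrow> real" where
  "partition_function S s \<theta> = (\<Sum>\<^sub>\<infinity>x\<in>S. exp (\<theta> \<bullet> s x))"

definition exp_distribution ::
    "'x set \<Rightarrow> ('x \<Rightarrow> real ^ 'd) \<Rightarrow> real ^ 'd \<Rightarrow> 'x measure" where
  "exp_distribution S s \<theta> =
     density (count_space S) (\<lambda>x. ennreal (exp (\<theta> \<bullet> s x) / partition_function S s \<theta>))"

text \<open>
  Minimal sufficiency of the statistics \<open>t A\<close> is not a separate assumption: since
  \<open>\<Theta>\<close> is open, two points have a likelihood ratio that is constant in \<open>\<theta>\<close> only if
  \<open>t A\<close> agrees on them (for nonempty \<open>\<Theta>\<close>).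
\<close>

locale exponential_families = configuration_spaces I \<A> X \<pi>
  for I :: "'i set" and \<A> :: "'i set set" and X :: "'i set \<Rightarrow> 'x set"
    and \<pi> :: "'i set \<Rightarrow> 'i set \<Rightarrow> 'x \<Rightarrow> 'x" +
  fixes \<Theta> :: "(real ^ 'd) set"
    and t :: "'i set \<Rightarrow> 'x \<Rightarrow> real ^ 'd"
  assumes open_\<Theta>: "open \<Theta>"
    and finite_partition_function: "A \<in> \<A> \<Longrightarrow> \<theta> \<in> \<Theta> \<Longrightarrow>
      (\<lambda>x. exp (\<theta> \<bullet> t A x)) summable_on X A"

definition projective ::
    "'i set set \<Rightarrow> ('i set \<Rightarrow> 'x set) \<Rightarrow> ('i set \<Rightarrow> 'i set \<Rightarrow> 'x \<Rightarrow> 'x) \<Rightarrow>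
     (real ^ 'd) set \<Rightarrow> ('i set \<Rightarrow> 'x \<Rightarrow> real ^ 'd) \<Rightarrow> bool" where
  "projective \<A> X \<pi> \<Theta> t \<longleftrightarrow>
     (\<forall>A\<in>\<A>. \<forall>B\<in>\<A>. A \<subseteq> B \<longrightarrow> (\<forall>\<theta>\<in>\<Theta>.
        exp_distribution (X A) (t A) \<theta> =
        distr (exp_distribution (X B) (t B) \<theta>) (count_space (X A)) (\<pi> B A)))"

lemma prob_space_exp_distribution:
  assumes sum: "(\<lambda>x. exp (\<theta> \<bullet> s x)) summable_on S" and "S \<noteq> {}"
  shows "prob_space (exp_distribution S s \<theta>)"
proof -
  let ?z = "partition_function S s \<theta>"
  from \<open>S \<noteq> {}\<close> obtain a where a: "a \<in> S" by blast
  have "exp (\<theta> \<bullet> s a) \<le> ?z"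
    unfolding partition_function_def
    using finite_sum_le_infsum[OF sum, of "{a}"] a by simp
  then have z: "?z > 0"
    using exp_gt_zero[of "\<theta> \<bullet> s a"] by linarith
  have abs: "Infinite_Set_Sum.abs_summable_on (\<lambda>x. exp (\<theta> \<bullet> s x)) S"
    by (subst abs_summable_equivalent[symmetric]) (simp add: sum)
  have "(\<integral>\<^sup>+x. ennreal (exp (\<theta> \<bullet> s x) / ?z) \<partial>count_space S) =
      (\<integral>\<^sup>+x. ennreal (1 / ?z) * ennreal (exp (\<theta> \<bullet> s x)) \<partial>count_space S)"
    using z by (intro nn_integral_cong) (simp flip: ennreal_mult)
  also have "\<dots> = ennreal (1 / ?z) * (\<integral>\<^sup>+x. ennreal (exp (\<theta> \<bullet> s x)) \<partial>count_space S)"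
    by (rule nn_integral_cmult) simp
  also have "(\<integral>\<^sup>+x. ennreal (exp (\<theta> \<bullet> s x)) \<partial>count_space S) = ennreal ?z"
    by (subst nn_integral_conv_infsetsum[OF abs])
       (simp_all add: infsetsum_infsum[OF abs] partition_function_def)
  also have "ennreal (1 / ?z) * ennreal ?z = 1"
    using z by (simp flip: ennreal_mult)
  finally have total: "(\<integral>\<^sup>+x. ennreal (exp (\<theta> \<bullet> s x) / ?z) \<partial>count_space S) = 1" .
  have "emeasure (exp_distribution S s \<theta>) (space (exp_distribution S s \<theta>)) =
      (\<integral>\<^sup>+x. ennreal (exp (\<theta> \<bullet> s x) / ?z) \<partial>count_space S)"
    unfolding exp_distribution_def
    by (subst emeasure_density) (auto intro!: nn_integral_cong)
  with total show ?thesis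
    by (intro prob_spaceI) simp
qed

end

theory Submission
  imports Defs "HOL-Complex_Analysis.Conformal_Mappings"
begin

text \<open>
  Write \<open>D w = t B w - t A (\<pi> B A w)\<close> for the increment. Projectivity says that
  the configurations \<open>w\<close> over a fixed \<open>x \<in> X A\<close> carry total mass \<open>p\<^sub>A \<theta> x\<close>; after division
  by \<open>exp (\<theta> \<bullet> t A x) / z\<^sub>B \<theta>\<close> it reads
  \[ \sum_{w \in X_B,\ \pi w = x} e^{\langle\theta, D w\rangle} = z_B(\theta) / z_A(\theta)
     \qquad (\theta \in \Theta), \]
  and the right-hand side does not depend on \<open>x\<close>. The left-hand side is the Laplace transform of
  the image under \<open>D\<close> of the counting measure on the fibre over \<open>x\<close>. As \<open>\<Theta>\<close> is open, the
  transform determines this image measure, so the number of points \<open>w\<close> over \<open>x\<close> with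
  \<open>D w = \<delta>\<close> is the same for all \<open>x\<close>. Each such point has mass
  \<open>exp (\<theta> \<bullet> \<delta>) * exp (\<theta> \<bullet> t A x) / z\<^sub>B \<theta>\<close>; hence the joint mass function of \<open>D\<close> and \<open>\<pi>\<close>
  factorises, \<open>D\<close> is independent of \<open>\<pi>\<close>, and therefore also of its function \<open>t A \<circ> \<pi>\<close>.

  The analytic part is \<open>exponential_sum_uniqueness\<close>: an absolutely convergent sum
  \<open>\<Sum> c s * exp (\<eta> \<bullet> f s)\<close> that vanishes for all \<open>\<eta>\<close> in a nonempty open set has
  \<open>\<Sum> c s = 0\<close> over every fibre of \<open>f\<close>. It is reduced to one variable by moving
  \<open>\<eta>\<close> along a line in a direction \<open>u\<close>, where the sum extends to a holomorphic function on a
  vertical strip (\<open>exponential_sum_vanishes_on_strip\<close>); this function is zero, in particular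
  on the imaginary axis. There the terms oscillate, and Cesaro means over the points
  \<open>0, \<i>, 2 * \<i>, \<dots>\<close> single out the terms that do not
  (\<open>coefficients_vanish_where_base_is_one\<close>). For a generic \<open>u\<close> these are
  exactly the terms of one fibre. The theorem applies this with \<open>f = D\<close> and with \<open>c\<close> the
  difference of the indicators of two fibres of \<open>\<pi>\<close>.
\<close>

section \<open>Uniqueness for exponential sums\<close>

lemma has_sum_diff:
  fixes f g :: "'a \<Rightarrow> real"
  assumes "(f has_sum a) S" "(g has_sum b) S"
  shows "((\<lambda>x. f x - g x) has_sum (a - b)) S"
  using has_sum_add[OF assms(1) has_sum_uminusI[OF assms(2)]] by simp

text \<open>
  Each of the countably many equations \<open>u \<bullet> v = r\<close> cuts out a hyperplane, which is a
  Lebesgue null set, so almost every \<open>u\<close> satisfies none of them.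
\<close>

lemma exists_vector_avoiding_countably_many_hyperplanes:
  fixes V :: "'b::euclidean_space set" and R :: "real set"
  assumes "countable V" "0 \<notin> V" "countable R"
  obtains u where "\<And>v. v \<in> V \<Longrightarrow> u \<bullet> v \<notin> R"
proof -
  have "negligible (\<Union>((\<lambda>(v, r). {u. v \<bullet> u = r}) ` (V \<times> R)))"
    using assms by (intro negligible_countable_Union) (auto intro!: negligible_hyperplane)
  then have "(\<Union>((\<lambda>(v, r). {u. v \<bullet> u = r}) ` (V \<times> R))) \<noteq> UNIV"
    using non_negligible_UNIV by metis
  then obtain u where "u \<notin> (\<Union>((\<lambda>(v, r). {u. v \<bullet> u = r}) ` (V \<times> R)))"
    by blast
  then have "u \<bullet> v \<notin> R" if "v \<in> V" for v
    using that by (auto simp: inner_commute)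
  then show thesis
    by (rule that)
qed

lemma Cesaro_mean_of_unimodular_powers:
  fixes w :: complex
  assumes "norm w = 1"
  shows "(\<lambda>N. (\<Sum>k<N. w ^ k) / of_nat N) \<longlonglongrightarrow> (if w = 1 then 1 else 0)"
proof (cases "w = 1")
  case True
  have "\<forall>\<^sub>F N in sequentially. (\<Sum>k<N. w ^ k) / of_nat N = 1"
    using eventually_gt_at_top[of 0] by eventually_elim (simp add: True)
  then show ?thesis
    using True by (simp add: tendsto_eventually)
next
  case False
  have bound: "norm (\<Sum>k<N. w ^ k) \<le> 2 / norm (1 - w)" for N
  proof -
    have "norm (1 - w ^ N) \<le> norm (1::complex) + norm (w ^ N)"
      by (rule norm_triangle_ineq4)
    then have "norm (1 - w ^ N) \<le> 2"
      using assms by (simp add: norm_power)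
    moreover have "(\<Sum>k<N. w ^ k) = (1 - w ^ N) / (1 - w)"
      using False by (simp add: sum_gp_strict)
    ultimately show ?thesis
      by (simp add: norm_divide divide_right_mono)
  qed
  have lim: "(\<lambda>N. 2 / norm (1 - w) / real N) \<longlonglongrightarrow> 0"
    by (rule lim_const_over_n)
  have "(\<lambda>N. (\<Sum>k<N. w ^ k) / of_nat N) \<longlonglongrightarrow> 0"
    by (rule Lim_null_comparison[OF always_eventually lim])
       (use divide_right_mono[OF bound] in \<open>simp add: norm_divide del: divide_divide_eq_left\<close>)
  then show ?thesis
    using False by simp
qed

text \<open>
  This is a mean ergodic argument. The average of the hypotheses over \<open>k < N\<close> is
  a vanishing sum with the same coefficients and with the Cesaro means of \<open>w s ^ k\<close> as factors.
  They are bounded by \<open>1\<close>, so the sum converges uniformly in \<open>N\<close> and the limit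
  \<open>N \<longlonglongrightarrow> \<infinity>\<close> may be taken term by term; it kills all terms with \<open>w s \<noteq> 1\<close>.
\<close>

lemma coefficients_vanish_where_base_is_one:
  fixes b w :: "'a \<Rightarrow> complex"
  assumes summable: "(\<lambda>s. norm (b s)) summable_on S"
    and unimodular: "\<And>s. s \<in> S \<Longrightarrow> norm (w s) = 1"
    and zero: "\<And>k::nat. ((\<lambda>s. b s * w s ^ k) has_sum 0) S"
  shows "(b has_sum 0) {s \<in> S. w s = 1}"
proof -
  define mean where "mean N s = (\<Sum>k<N. w s ^ k) / of_nat N" for N s
  define lim where "lim s = b s * (if w s = 1 then 1 else 0)" for s
  have mean_le: "norm (mean N s) \<le> 1" if "s \<in> S" for N s
  proof -
    have "norm (\<Sum>k<N. w s ^ k) \<le> (\<Sum>k<N. norm (w s ^ k))"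
      by (rule norm_sum)
    also have "\<dots> = real N"
      using unimodular[OF that] by (simp add: norm_power)
    finally show ?thesis
      by (cases "N = 0") (simp_all add: mean_def norm_divide)
  qed
  have mean_zero: "((\<lambda>s. b s * mean N s) has_sum 0) S" for N
  proof -
    have "((\<lambda>s. \<Sum>k<N. b s * w s ^ k) has_sum (\<Sum>k<N. 0)) S"
      by (induction N) (use has_sum_add[OF _ zero] in fastforce)+
    then have "((\<lambda>s. (\<Sum>k<N. b s * w s ^ k) * (1 / of_nat N)) has_sum (0 * (1 / of_nat N))) S"
      by (intro has_sum_cmult_left) simp
    then show ?thesis
      by (simp add: mean_def sum_distrib_left)
  qed
  have "uniform_limit UNIV (\<lambda>F N. \<Sum>s\<in>F. b s * mean N s) (\<lambda>_. 0) (finite_subsets_at_top S)"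
    by (rule Weierstrass_m_test_general'[OF _ mean_zero summable])
       (use mean_le in \<open>auto simp: norm_mult intro!: mult_left_le\<close>)
  moreover have "\<forall>\<^sub>F F in finite_subsets_at_top S.
      (\<lambda>N. \<Sum>s\<in>F. b s * mean N s) \<longlonglongrightarrow> (\<Sum>s\<in>F. lim s)"
  proof (rule eventually_finite_subsets_at_top_weakI)
    fix F assume "finite F" "F \<subseteq> S"
    then show "(\<lambda>N. \<Sum>s\<in>F. b s * mean N s) \<longlonglongrightarrow> (\<Sum>s\<in>F. lim s)"
      unfolding mean_def lim_def
      by (intro tendsto_sum tendsto_mult tendsto_const Cesaro_mean_of_unimodular_powers unimodular)
         auto
  qed
  moreover have lim_sum: "(lim has_sum infsum lim S) S"
  proof (rule has_sum_infsum)
    have "(\<lambda>s. norm (lim s)) summable_on S"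
      by (rule Infinite_Sum.abs_summable_on_comparison_test'[OF summable]) (simp add: lim_def)
    then show "lim summable_on S"
      by (rule abs_summable_summable)
  qed
  ultimately have "(\<lambda>N::nat. 0) \<longlonglongrightarrow> infsum lim S"
    unfolding has_sum_def
    by (intro swap_uniform_limit'[where F = "finite_subsets_at_top S" and S = UNIV
          and f = "\<lambda>F N. \<Sum>s\<in>F. b s * mean N s" and g = "sum lim"])
       auto
  then have "infsum lim S = 0"
    by (simp add: LIMSEQ_const_iff)
  with lim_sum have "(lim has_sum 0) S"
    by simp
  then show ?thesis
    by (subst has_sum_cong_neutral[of S _ lim]) (auto simp: lim_def)
qed

text \<open>
  Since \<open>\<bar>exp (z * r)\<bar> \<le> exp (\<epsilon> * r) + exp (- \<epsilon> * r)\<close> on the strip, the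
  sums at the two real points \<open>\<plusminus>\<epsilon>\<close> dominate the sum at every point of the
  strip. The sum is thus holomorphic, and the identity theorem carries its
  zeros from the real segment to the whole strip.
\<close>

lemma exponential_sum_vanishes_on_strip:
  fixes b r :: "'a \<Rightarrow> real"
  assumes "\<epsilon> > 0"
    and zero: "\<And>x. \<bar>x\<bar> \<le> \<epsilon> \<Longrightarrow> ((\<lambda>s. b s * exp (x * r s)) has_sum 0) S"
    and z: "\<bar>Re z\<bar> < \<epsilon>"
  shows "((\<lambda>s. of_real (b s) * exp (z * of_real (r s))) has_sum 0) S"
proof -
  define strip where "strip = {z. \<bar>Re z\<bar> < \<epsilon>}"
  define M where "M s = norm (b s * exp (\<epsilon> * r s)) + norm (b s * exp (- \<epsilon> * r s))" for s
  define F where "F z = (\<Sum>\<^sub>\<infinity>s\<in>S. of_real (b s) * exp (z * of_real (r s)))" for z :: complex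
  have M: "M summable_on S"
    unfolding M_def
  proof (rule summable_on_add)
    show "(\<lambda>s. norm (b s * exp (\<epsilon> * r s))) summable_on S"
      using has_sum_imp_summable[OF zero[of \<epsilon>]] \<open>\<epsilon> > 0\<close>
      by (intro summable_on_iff_abs_summable_on_real[THEN iffD1]) simp
    show "(\<lambda>s. norm (b s * exp (- \<epsilon> * r s))) summable_on S"
      using has_sum_imp_summable[OF zero[of "- \<epsilon>"]] \<open>\<epsilon> > 0\<close>
      by (intro summable_on_iff_abs_summable_on_real[THEN iffD1]) simp
  qed
  have bound: "norm (of_real (b s) * exp (z * of_real (r s))) \<le> M s" if "z \<in> strip" for z :: complex and s
  proof -
    have "Re z * r s \<le> \<bar>Re z\<bar> * \<bar>r s\<bar>"
      by (metis abs_ge_self abs_mult)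
    also have "\<dots> \<le> \<epsilon> * \<bar>r s\<bar>"
      using that by (intro mult_right_mono) (auto simp: strip_def)
    finally have "exp (Re z * r s) \<le> exp (\<epsilon> * \<bar>r s\<bar>)"
      by simp
    also have "\<dots> \<le> exp (\<epsilon> * r s) + exp (- \<epsilon> * r s)"
      by (cases "r s \<ge> 0") auto
    finally have "\<bar>b s\<bar> * exp (Re z * r s) \<le> \<bar>b s\<bar> * (exp (\<epsilon> * r s) + exp (- \<epsilon> * r s))"
      by (intro mult_left_mono) auto
    then show ?thesis
      by (simp add: M_def norm_mult abs_mult distrib_left)
  qed
  have uniform: "uniform_limit strip (\<lambda>G z. \<Sum>s\<in>G. of_real (b s) * exp (z * of_real (r s))) F
      (finite_subsets_at_top S)"
    unfolding F_def by (rule Weierstrass_m_test_general[OF bound M])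
  have "strip = {z. - \<epsilon> < Re z} \<inter> {z. Re z < \<epsilon>}"
    by (auto simp: strip_def)
  then have open_strip: "open strip" and convex_strip: "convex strip"
    by (auto intro!: open_Int convex_Int open_halfspace_Re_lt open_halfspace_Re_gt
        convex_halfspace_Re_lt convex_halfspace_Re_gt)
  have hol: "F holomorphic_on strip"
    unfolding holomorphic_on_def
  proof
    fix z assume "z \<in> strip"
    then obtain \<rho> where \<rho>: "\<rho> > 0" "cball z \<rho> \<subseteq> strip"
      using open_strip open_contains_cball by blast
    have "\<forall>\<^sub>F G in finite_subsets_at_top S.
        continuous_on (cball z \<rho>) (\<lambda>z. \<Sum>s\<in>G. of_real (b s) * exp (z * of_real (r s))) \<and>
        (\<lambda>z. \<Sum>s\<in>G. of_real (b s) * exp (z * of_real (r s))) holomorphic_on ball z \<rho>"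
      by (intro always_eventually allI conjI continuous_intros holomorphic_intros)
    then have "F holomorphic_on ball z \<rho>"
      using uniform_limit_on_subset[OF uniform \<rho>(2)] finite_subsets_at_top_neq_bot
      by (rule holomorphic_uniform_limit)
    then show "F field_differentiable at z within strip"
      using \<rho>(1)
      by (auto intro: field_differentiable_at_within[OF holomorphic_on_imp_differentiable_at[of F "ball z \<rho>"]])
  qed
  have F_zero: "F x = 0" if "x \<in> of_real ` {0<..<\<epsilon>}" for x
  proof -
    from that obtain y where y: "x = of_real y" "\<bar>y\<bar> \<le> \<epsilon>"
      by auto
    have "((\<lambda>s. of_real (b s * exp (y * r s)) :: complex) has_sum of_real 0) S"
      by (rule has_sum_of_real) (use zero y in auto)
    then show ?thesis
      unfolding F_def y by (intro infsumI) (simp add: exp_of_real flip: of_real_mult)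
  qed
  have limpt: "(0::complex) islimpt of_real ` {0<..<\<epsilon>}"
  proof -
    have "(0::real) islimpt {0<..<\<epsilon>}"
      using \<open>\<epsilon> > 0\<close> by (rule islimpt_greaterThanLessThan1)
    then have "of_real 0 islimpt (of_real ` {0<..<\<epsilon>} :: complex set)"
      by (intro islimpt_isCont_image) (auto simp: eventually_at_filter)
    then show ?thesis
      by simp
  qed
  have "F z = 0"
    by (rule analytic_continuation[OF hol open_strip convex_connected[OF convex_strip] _ _ limpt F_zero])
       (use \<open>\<epsilon> > 0\<close> z in \<open>auto simp: strip_def\<close>)
  moreover have "(\<lambda>s. of_real (b s) * exp (z * of_real (r s))) summable_on S"
    by (rule abs_summable_summable, rule Infinite_Sum.abs_summable_on_comparison_test'[OF M bound])
       (use z in \<open>simp add: strip_def\<close>)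
  ultimately show ?thesis
    by (simp add: F_def has_sum_iff)
qed

text \<open>
  Uniqueness of the Laplace transform for discrete signed measures in several variables. The
  map \<open>f\<close> may take a value infinitely often; what is determined is the
  total weight of each value, that is, the image of the weights under \<open>f\<close>.
\<close>

theorem exponential_sum_uniqueness:
  fixes \<Theta> :: "'b::euclidean_space set" and f :: "'a \<Rightarrow> 'b" and c :: "'a \<Rightarrow> real"
  assumes "countable S" "open \<Theta>" "\<theta> \<in> \<Theta>"
    and zero: "\<And>\<eta>. \<eta> \<in> \<Theta> \<Longrightarrow> ((\<lambda>s. c s * exp (\<eta> \<bullet> f s)) has_sum 0) S"
  shows "(c has_sum 0) {s \<in> S. f s = \<delta>}"
proof -
  \<comment> \<open>The direction \<open>u\<close> is chosen such that \<open>exp (\<i> * (u \<bullet> (f s - \<delta>))) = 1\<close> forces \<open>f s = \<delta>\<close>.\<close>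
  have "countable ((\<lambda>s. f s - \<delta>) ` S - {0})"
    using \<open>countable S\<close> by auto
  then obtain u where u: "\<And>v. v \<in> (\<lambda>s. f s - \<delta>) ` S - {0} \<Longrightarrow> u \<bullet> v \<notin> range (\<lambda>n::int. of_int (2 * n) * pi)"
    by (rule exists_vector_avoiding_countably_many_hyperplanes
        [where R = "range (\<lambda>n::int. of_int (2 * n) * pi)"]) auto
  obtain \<rho> where \<rho>: "\<rho> > 0" "cball \<theta> \<rho> \<subseteq> \<Theta>"
    using assms open_contains_cball by blast
  \<comment> \<open>The summand \<open>1\<close> covers the direction \<open>u = 0\<close>, which can occur when \<open>f\<close> is constant.\<close>
  define \<epsilon> where "\<epsilon> = \<rho> / (norm u + 1)"
  have \<epsilon>: "\<epsilon> > 0"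
    using \<rho> by (simp add: \<epsilon>_def add_nonneg_pos)
  have segment: "\<theta> + x *\<^sub>R u \<in> \<Theta>" if "\<bar>x\<bar> \<le> \<epsilon>" for x
  proof -
    have "\<bar>x\<bar> * norm u \<le> \<epsilon> * (norm u + 1)"
      using that \<epsilon> by (intro mult_mono) auto
    also have "\<dots> = \<rho>"
      by (simp add: \<epsilon>_def add_nonneg_eq_0_iff)
    finally show ?thesis
      using \<rho>(2) by (auto simp: dist_norm)
  qed
  define b where "b s = c s * exp (\<theta> \<bullet> f s)" for s
  define r where "r s = u \<bullet> (f s - \<delta>)" for s
  define w where "w s = exp (\<i> * of_real (r s))" for s
  have real_zero: "((\<lambda>s. b s * exp (x * r s)) has_sum 0) S" if "\<bar>x\<bar> \<le> \<epsilon>" for x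
  proof -
    have "b s * exp (x * r s) = c s * exp ((\<theta> + x *\<^sub>R u) \<bullet> f s) * exp (- x * (u \<bullet> \<delta>))" for s
      by (simp add: b_def r_def algebra_simps flip: exp_add)
    then show ?thesis
      using has_sum_cmult_left[OF zero[OF segment[OF that]], of "exp (- x * (u \<bullet> \<delta>))"] by simp
  qed
  have "(\<lambda>s. norm (b s)) summable_on S"
    using has_sum_imp_summable[OF real_zero[of 0]] \<epsilon>
    by (intro summable_on_iff_abs_summable_on_real[THEN iffD1]) simp
  then have "((\<lambda>s. of_real (b s) :: complex) has_sum 0) {s \<in> S. w s = 1}"
  proof (intro coefficients_vanish_where_base_is_one)
    fix k :: nat
    have "w s ^ k = exp ((of_nat k * \<i>) * of_real (r s))" for s
      by (simp add: w_def mult.assoc flip: exp_of_nat_mult)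
    then show "((\<lambda>s. of_real (b s) * w s ^ k) has_sum 0) S"
      using exponential_sum_vanishes_on_strip[OF \<epsilon> real_zero, of "of_nat k * \<i>"] \<epsilon> by simp
  qed (auto simp: w_def)
  also have "{s \<in> S. w s = 1} = {s \<in> S. f s = \<delta>}"
  proof (intro Collect_cong conj_cong refl)
    fix s assume "s \<in> S"
    then show "w s = 1 \<longleftrightarrow> f s = \<delta>"
      using u[of "f s - \<delta>"] by (auto simp: w_def r_def exp_eq_1)
  qed
  finally have "(b has_sum 0) {s \<in> S. f s = \<delta>}"
    using has_sum_of_real_iff[of b _ 0, where 'a = complex] by simp
  then have "((\<lambda>s. b s * exp (- (\<theta> \<bullet> \<delta>))) has_sum (0 * exp (- (\<theta> \<bullet> \<delta>)))) {s \<in> S. f s = \<delta>}"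
    by (rule has_sum_cmult_left)
  moreover have "b s * exp (- (\<theta> \<bullet> \<delta>)) = c s" if "f s = \<delta>" for s
    using that by (simp add: b_def mult.assoc flip: exp_add)
  ultimately show ?thesis
    using has_sum_cong[of "{s \<in> S. f s = \<delta>}" "\<lambda>s. b s * exp (- (\<theta> \<bullet> \<delta>))" c] by simp
qed

section \<open>Discrete distributions\<close>

lemma partition_function_pos:
  assumes summable: "(\<lambda>x. exp (\<theta> \<bullet> s x)) summable_on S" and "S \<noteq> {}"
  shows "partition_function S s \<theta> > 0"
proof -
  from \<open>S \<noteq> {}\<close> obtain a where "a \<in> S" by blast
  then have "exp (\<theta> \<bullet> s a) \<le> partition_function S s \<theta>"
    unfolding partition_function_def
    using finite_sum_le_infsum[OF summable, of "{a}"] by simp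
  then show ?thesis
    using exp_gt_zero[of "\<theta> \<bullet> s a"] by linarith
qed

text \<open>
  Probabilities are turned into sums of the unnormalised weights, so that the results on
  exponential sums apply to them.
\<close>

lemma has_sum_measure_exp_distribution:
  assumes summable: "(\<lambda>x. exp (\<theta> \<bullet> s x)) summable_on S" and "E \<subseteq> S"
  shows "((\<lambda>x. exp (\<theta> \<bullet> s x)) has_sum
      (partition_function S s \<theta> * measure (exp_distribution S s \<theta>) E)) E"
proof (cases "S = {}")
  case True
  then show ?thesis using assms by simp
next
  case False
  let ?z = "partition_function S s \<theta>"
  have E: "(\<lambda>x. exp (\<theta> \<bullet> s x)) summable_on E"
    using summable \<open>E \<subseteq> S\<close> by (rule summable_on_subset_banach)
  have z: "?z > 0"
    by (rule partition_function_pos[OF summable False])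
  have abs: "Infinite_Set_Sum.abs_summable_on (\<lambda>x. exp (\<theta> \<bullet> s x) / ?z) E"
    using summable_on_cmult_left[OF E, of "inverse ?z"] z
    by (subst abs_summable_equivalent[symmetric]) (simp add: divide_inverse)
  have "emeasure (exp_distribution S s \<theta>) E =
      (\<integral>\<^sup>+x. ennreal (exp (\<theta> \<bullet> s x) / ?z) * indicator E x \<partial>count_space S)"
    unfolding exp_distribution_def using \<open>E \<subseteq> S\<close> by (subst emeasure_density) auto
  also have "\<dots> = (\<integral>\<^sup>+x. ennreal (exp (\<theta> \<bullet> s x) / ?z) \<partial>count_space E)"
    using \<open>E \<subseteq> S\<close>
    by (subst nn_integral_count_space_indicator[of E])
       (auto simp: nn_integral_count_space_indicator[of S] indicator_def intro!: nn_integral_cong)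
  also have "\<dots> = ennreal (\<Sum>\<^sub>\<infinity>x\<in>E. exp (\<theta> \<bullet> s x) / ?z)"
    using z by (subst nn_integral_conv_infsetsum[OF abs]) (simp_all add: infsetsum_infsum[OF abs])
  also have "(\<Sum>\<^sub>\<infinity>x\<in>E. exp (\<theta> \<bullet> s x) / ?z) = (\<Sum>\<^sub>\<infinity>x\<in>E. exp (\<theta> \<bullet> s x)) / ?z"
    using infsum_cmult_left'[of "\<lambda>x. exp (\<theta> \<bullet> s x)" "inverse ?z" E] by (simp add: divide_inverse)
  finally have "measure (exp_distribution S s \<theta>) E = (\<Sum>\<^sub>\<infinity>x\<in>E. exp (\<theta> \<bullet> s x)) / ?z"
    using z by (simp add: measure_def infsum_nonneg)
  then show ?thesis
    using z E by (simp add: has_sum_iff)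
qed

text \<open>
  The hypothesis says, without dividing by probabilities that may be zero, that the conditional law
  of \<open>Y\<close> given \<open>X = x\<close> is the same for all \<open>x\<close>. Summed over \<open>x'\<close>, it becomes the
  product formula for the point masses. The conclusion is an equation of laws rather than
  \<open>indep_var\<close> because the latter forces both variables to have values in one type.
\<close>

lemma (in prob_space) product_law_if_fibre_laws_proportional:
  assumes countable: "countable S" "countable T"
    and X: "X \<in> measurable M (count_space S)" and Y: "Y \<in> measurable M (count_space T)"
    and proportional: "\<And>x x' y. x \<in> S \<Longrightarrow> x' \<in> S \<Longrightarrow> y \<in> T \<Longrightarrow>
      prob {\<omega> \<in> space M. X \<omega> = x \<and> Y \<omega> = y} * prob {\<omega> \<in> space M. X \<omega> = x'} =
      prob {\<omega> \<in> space M. X \<omega> = x' \<and> Y \<omega> = y} * prob {\<omega> \<in> space M. X \<omega> = x}"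
  shows "distr M (count_space T) Y \<Otimes>\<^sub>M distr M (count_space S) X =
    distr M (count_space T \<Otimes>\<^sub>M count_space S) (\<lambda>\<omega>. (Y \<omega>, X \<omega>))"
proof -
  note [measurable] = X Y
  have XS: "X \<omega> \<in> S" if "\<omega> \<in> space M" for \<omega>
    using measurable_space[OF X that] by simp
  have ev[measurable]: "{\<omega> \<in> space M. X \<omega> = x} \<in> events" "{\<omega> \<in> space M. Y \<omega> = y} \<in> events" for x y
  proof -
    have "{\<omega> \<in> space M. X \<omega> = x} = X -` ({x} \<inter> S) \<inter> space M"
      using XS by auto
    also have "\<dots> \<in> events"
      by (rule measurable_sets[OF X]) simp
    finally show "{\<omega> \<in> space M. X \<omega> = x} \<in> events" .
    have "{\<omega> \<in> space M. Y \<omega> = y} = Y -` ({y} \<inter> T) \<inter> space M"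
      using measurable_space[OF Y] by auto
    also have "\<dots> \<in> events"
      by (rule measurable_sets[OF Y]) simp
    finally show "{\<omega> \<in> space M. Y \<omega> = y} \<in> events" .
  qed
  have total: "(\<integral>\<^sup>+x. emeasure M {\<omega> \<in> space M. X \<omega> = x \<and> Q \<omega>} \<partial>count_space S) =
      emeasure M {\<omega> \<in> space M. Q \<omega>}" if [measurable]: "{\<omega> \<in> space M. Q \<omega>} \<in> events" for Q
  proof -
    have "{\<omega> \<in> space M. X \<omega> = x \<and> Q \<omega>} \<in> events" for x
      using sets.Int[OF ev(1)[of x] that] by (simp add: Collect_conj_eq Int_ac)
    then have "emeasure M (\<Union>x\<in>S. {\<omega> \<in> space M. X \<omega> = x \<and> Q \<omega>}) =
        (\<integral>\<^sup>+x. emeasure M {\<omega> \<in> space M. X \<omega> = x \<and> Q \<omega>} \<partial>count_space S)"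
      using countable(1) by (intro emeasure_UN_countable) (auto simp: disjoint_family_on_def)
    moreover have "(\<Union>x\<in>S. {\<omega> \<in> space M. X \<omega> = x \<and> Q \<omega>}) = {\<omega> \<in> space M. Q \<omega>}"
      using XS by auto
    ultimately show ?thesis
      by simp
  qed
  have product: "emeasure M {\<omega> \<in> space M. X \<omega> = x \<and> Y \<omega> = y} =
      emeasure M {\<omega> \<in> space M. X \<omega> = x} * emeasure M {\<omega> \<in> space M. Y \<omega> = y}"
    if x: "x \<in> S" and y: "y \<in> T" for x y
  proof -
    have "emeasure M {\<omega> \<in> space M. X \<omega> = x \<and> Y \<omega> = y} =
        emeasure M {\<omega> \<in> space M. X \<omega> = x \<and> Y \<omega> = y} *
        (\<integral>\<^sup>+x'. emeasure M {\<omega> \<in> space M. X \<omega> = x'} \<partial>count_space S)"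
      using total[of "\<lambda>_. True"] by (simp add: emeasure_space_1)
    also have "\<dots> = (\<integral>\<^sup>+x'. emeasure M {\<omega> \<in> space M. X \<omega> = x \<and> Y \<omega> = y} *
        emeasure M {\<omega> \<in> space M. X \<omega> = x'} \<partial>count_space S)"
      by (simp add: nn_integral_cmult)
    also have "\<dots> = (\<integral>\<^sup>+x'. emeasure M {\<omega> \<in> space M. X \<omega> = x} *
        emeasure M {\<omega> \<in> space M. X \<omega> = x' \<and> Y \<omega> = y} \<partial>count_space S)"
      using proportional[OF x _ y]
      by (intro nn_integral_cong) (simp add: emeasure_eq_measure mult.commute flip: ennreal_mult)
    also have "\<dots> = emeasure M {\<omega> \<in> space M. X \<omega> = x} * emeasure M {\<omega> \<in> space M. Y \<omega> = y}"
      by (simp add: nn_integral_cmult total)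
    finally show ?thesis .
  qed
  interpret PX: prob_space "distr M (count_space S) X"
    by (rule prob_space_distr) simp
  show ?thesis
  proof (rule measure_eqI_countable)
    show "sets (distr M (count_space T) Y \<Otimes>\<^sub>M distr M (count_space S) X) = Pow (T \<times> S)"
      using pair_measure_countable[OF countable(2,1)]
      by (metis sets_count_space sets_distr sets_pair_measure_cong)
    show "sets (distr M (count_space T \<Otimes>\<^sub>M count_space S) (\<lambda>\<omega>. (Y \<omega>, X \<omega>))) = Pow (T \<times> S)"
      by (simp add: pair_measure_countable[OF countable(2,1)])
    show "countable (T \<times> S)"
      using countable by simp
    fix a assume "a \<in> T \<times> S"
    then obtain x y where a: "a = (y, x)" and xy: "x \<in> S" "y \<in> T"
      by auto
    have "emeasure (distr M (count_space T) Y \<Otimes>\<^sub>M distr M (count_space S) X) ({y} \<times> {x}) =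
        emeasure (distr M (count_space T) Y) {y} * emeasure (distr M (count_space S) X) {x}"
      using xy by (intro PX.emeasure_pair_measure_Times) auto
    also have "\<dots> = emeasure M {\<omega> \<in> space M. Y \<omega> = y} * emeasure M {\<omega> \<in> space M. X \<omega> = x}"
      using xy by (simp add: emeasure_distr vimage_def Int_def conj_commute)
    also have "\<dots> = emeasure M {\<omega> \<in> space M. X \<omega> = x \<and> Y \<omega> = y}"
      using product[OF xy] by (simp add: mult.commute)
    also have "\<dots> = emeasure (distr M (count_space T \<Otimes>\<^sub>M count_space S) (\<lambda>\<omega>. (Y \<omega>, X \<omega>))) {a}"
    proof (subst emeasure_distr)
      show "{a} \<in> sets (count_space T \<Otimes>\<^sub>M count_space S)"
        using xy unfolding a pair_measure_countable[OF countable(2,1)] by simp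
    qed (auto simp: a intro!: arg_cong[where f = "emeasure M"])
    finally show "emeasure (distr M (count_space T) Y \<Otimes>\<^sub>M distr M (count_space S) X) {a} =
        emeasure (distr M (count_space T \<Otimes>\<^sub>M count_space S) (\<lambda>\<omega>. (Y \<omega>, X \<omega>))) {a}"
      by (simp add: a)
  qed
qed

text \<open>
  This returns from product laws to \<open>indep_var\<close>: the maps \<open>g\<close> and \<open>h\<close> bring the
  two variables into a common type, and the image of a product measure under \<open>g \<times> h\<close>
  is again a product.
\<close>

lemma (in prob_space) indep_var_compose_if_product_law:
  assumes X[measurable]: "X \<in> measurable M S" and Y[measurable]: "Y \<in> measurable M T"
    and law: "distr M T Y \<Otimes>\<^sub>M distr M S X = distr M (T \<Otimes>\<^sub>M S) (\<lambda>\<omega>. (Y \<omega>, X \<omega>))"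
    and h[measurable]: "h \<in> measurable S K" and g[measurable]: "g \<in> measurable T N"
  shows "indep_var N (g \<circ> Y) K (h \<circ> X)"
proof -
  interpret hX: prob_space "distr (distr M S X) K h"
    by (intro prob_space.prob_space_distr prob_space_distr) simp_all
  have "distr M N (g \<circ> Y) \<Otimes>\<^sub>M distr M K (h \<circ> X) =
      distr (distr M T Y) N g \<Otimes>\<^sub>M distr (distr M S X) K h"
    by (simp add: distr_distr)
  also have "\<dots> = distr (distr M T Y \<Otimes>\<^sub>M distr M S X) (N \<Otimes>\<^sub>M K) (\<lambda>(y, x). (g y, h x))"
    by (rule pair_measure_distr) (simp_all add: hX.sigma_finite_measure_axioms)
  also have "\<dots> = distr M (N \<Otimes>\<^sub>M K) (\<lambda>\<omega>. ((g \<circ> Y) \<omega>, (h \<circ> X) \<omega>))"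
    unfolding law by (subst distr_distr) (simp_all add: comp_def)
  finally show ?thesis
    by (simp add: indep_var_distribution_eq)
qed

section \<open>Projective exponential families\<close>

text \<open>
  The proof compares the fibres of \<open>\<pi> B A\<close> over two points \<open>x\<close> and \<open>x'\<close>. Below,
  \<open>fibre_sum\<close> is the Laplace transform of the increments over \<open>x\<close>, for all \<open>\<eta> \<in> \<Theta>\<close>, and
  \<open>multiplicity\<close> expresses the number of points over \<open>x\<close> with increment \<open>\<delta>\<close> by a
  probability at the one parameter \<open>\<theta>\<close>.
\<close>

theorem proposition1:
  fixes I :: "'i set" and \<A> :: "'i set set"
    and X :: "'i set \<Rightarrow> 'x set"
    and \<pi> :: "'i set \<Rightarrow> 'i set \<Rightarrow> 'x \<Rightarrow> 'x"
    and \<Theta> :: "(real ^ 'd) set"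
    and t :: "'i set \<Rightarrow> 'x \<Rightarrow> real ^ 'd"
  assumes "exponential_families I \<A> X \<pi> \<Theta> t"
    and "projective \<A> X \<pi> \<Theta> t"
  shows "\<forall>A\<in>\<A>. \<forall>B\<in>\<A>. A \<subseteq> B \<longrightarrow> (\<forall>\<theta>\<in>\<Theta>.
    prob_space.indep_var (exp_distribution (X B) (t B) \<theta>)
      borel (\<lambda>w. t B w - t A (\<pi> B A w))
      borel (\<lambda>w. t A (\<pi> B A w)))"
proof (intro ballI impI)
  fix A B \<theta> assume A: "A \<in> \<A>" and B: "B \<in> \<A>" and "A \<subseteq> B" and \<theta>: "\<theta> \<in> \<Theta>"
  interpret exponential_families I \<A> X \<pi> \<Theta> t by fact
  define D where "D w = t B w - t A (\<pi> B A w)" for w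
  define P where "P \<eta> = exp_distribution (X B) (t B) \<eta>" for \<eta>
  define z where "z C \<eta> = partition_function (X C) (t C) \<eta>" for C \<eta>
  have prob_P: "prob_space (P \<eta>)" if "\<eta> \<in> \<Theta>" for \<eta>
    unfolding P_def using that B
    by (intro prob_space_exp_distribution finite_partition_function nonempty_X)
  interpret prob_space "P \<theta>"
    by (rule prob_P) (rule \<theta>)
  have space_P[simp]: "space (P \<eta>) = X B" and sets_P[simp]: "sets (P \<eta>) = Pow (X B)" for \<eta>
    by (simp_all add: P_def exp_distribution_def)
  have \<pi>: "\<pi> B A w \<in> X A" if "w \<in> X B" for w
    using bij_betwE[OF product[OF B \<open>A \<subseteq> B\<close>]] that by auto
  have z_pos: "z C \<eta> > 0" if "C \<in> \<A>" "\<eta> \<in> \<Theta>" for C \<eta>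
    unfolding z_def using that
    by (intro partition_function_pos finite_partition_function nonempty_X)

  have marginal: "exp (\<eta> \<bullet> t A x) = z A \<eta> * measure (P \<eta>) {w \<in> X B. \<pi> B A w = x}"
    if x: "x \<in> X A" and \<eta>: "\<eta> \<in> \<Theta>" for x \<eta>
  proof -
    have "((\<lambda>x. exp (\<eta> \<bullet> t A x)) has_sum
        (z A \<eta> * measure (exp_distribution (X A) (t A) \<eta>) {x})) {x}"
      unfolding z_def using x A \<eta>
      by (intro has_sum_measure_exp_distribution finite_partition_function) auto
    then have "exp (\<eta> \<bullet> t A x) = z A \<eta> * measure (exp_distribution (X A) (t A) \<eta>) {x}"
      by (auto simp: has_sum_finite_iff)
    also have "exp_distribution (X A) (t A) \<eta> = distr (P \<eta>) (count_space (X A)) (\<pi> B A)"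
      using assms(2) A B \<open>A \<subseteq> B\<close> \<eta>
      unfolding projective_def P_def by blast
    also have "measure \<dots> {x} = measure (P \<eta>) {w \<in> X B. \<pi> B A w = x}"
      using x \<pi> by (subst measure_distr)
        (auto simp: measurable_def intro!: arg_cong[where f = "measure (P \<eta>)"])
    finally show ?thesis .
  qed
  have fibre_sum: "((\<lambda>w. if \<pi> B A w = x then exp (\<eta> \<bullet> D w) else 0) has_sum (z B \<eta> / z A \<eta>)) (X B)"
    if x: "x \<in> X A" and \<eta>: "\<eta> \<in> \<Theta>" for x \<eta>
  proof -
    have "((\<lambda>w. exp (\<eta> \<bullet> t B w)) has_sum (z B \<eta> * measure (P \<eta>) {w \<in> X B. \<pi> B A w = x}))
        {w \<in> X B. \<pi> B A w = x}"
      unfolding z_def P_def using B \<eta>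
      by (intro has_sum_measure_exp_distribution finite_partition_function) auto
    then have "((\<lambda>w. exp (\<eta> \<bullet> t B w) * exp (- (\<eta> \<bullet> t A x))) has_sum
        (z B \<eta> * measure (P \<eta>) {w \<in> X B. \<pi> B A w = x} * exp (- (\<eta> \<bullet> t A x))))
        {w \<in> X B. \<pi> B A w = x}"
      by (rule has_sum_cmult_left)
    also have "z B \<eta> * measure (P \<eta>) {w \<in> X B. \<pi> B A w = x} * exp (- (\<eta> \<bullet> t A x)) = z B \<eta> / z A \<eta>"
      using marginal[OF x \<eta>] exp_not_eq_zero[of "\<eta> \<bullet> t A x"]
      by (simp add: exp_minus divide_inverse)
    finally show ?thesis
      by (subst has_sum_cong_neutral[where S = "X B" and T = "{w \<in> X B. \<pi> B A w = x}"
            and g = "\<lambda>w. exp (\<eta> \<bullet> t B w) * exp (- (\<eta> \<bullet> t A x))"])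
         (auto simp: D_def inner_diff_right simp flip: exp_add)
  qed
  have multiplicity: "((\<lambda>w. if \<pi> B A w = x then 1 else 0) has_sum
      (z B \<theta> * exp (- (\<theta> \<bullet> \<delta>)) * exp (- (\<theta> \<bullet> t A x)) * prob {w \<in> X B. \<pi> B A w = x \<and> D w = \<delta>}))
      {w \<in> X B. D w = \<delta>}" for x \<delta>
  proof -
    have "((\<lambda>w. exp (\<theta> \<bullet> t B w)) has_sum (z B \<theta> * prob {w \<in> X B. \<pi> B A w = x \<and> D w = \<delta>}))
        {w \<in> X B. \<pi> B A w = x \<and> D w = \<delta>}"
      unfolding z_def P_def using B \<theta>
      by (intro has_sum_measure_exp_distribution finite_partition_function) auto
    then have "((\<lambda>w. exp (\<theta> \<bullet> t B w) * (exp (- (\<theta> \<bullet> \<delta>)) * exp (- (\<theta> \<bullet> t A x)))) has_sum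
        (z B \<theta> * prob {w \<in> X B. \<pi> B A w = x \<and> D w = \<delta>} * (exp (- (\<theta> \<bullet> \<delta>)) * exp (- (\<theta> \<bullet> t A x)))))
        {w \<in> X B. \<pi> B A w = x \<and> D w = \<delta>}"
      by (rule has_sum_cmult_left)
    then show ?thesis
      by (subst has_sum_cong_neutral[where S = "{w \<in> X B. D w = \<delta>}"
            and T = "{w \<in> X B. \<pi> B A w = x \<and> D w = \<delta>}"
            and g = "\<lambda>w. exp (\<theta> \<bullet> t B w) * (exp (- (\<theta> \<bullet> \<delta>)) * exp (- (\<theta> \<bullet> t A x)))"])
         (auto simp: D_def inner_diff_right mult_ac simp flip: exp_add)
  qed
  have proportional: "prob {w \<in> X B. \<pi> B A w = x \<and> D w = \<delta>} * prob {w \<in> X B. \<pi> B A w = x'} =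
      prob {w \<in> X B. \<pi> B A w = x' \<and> D w = \<delta>} * prob {w \<in> X B. \<pi> B A w = x}"
    if x: "x \<in> X A" and x': "x' \<in> X A" for x x' \<delta>
  proof -
    let ?e = "\<lambda>y w. if \<pi> B A w = y then 1 else (0::real)"
    let ?p = "\<lambda>y. prob {w \<in> X B. \<pi> B A w = y \<and> D w = \<delta>}"
    \<comment> \<open>The transforms over \<open>x\<close> and \<open>x'\<close> agree on the open set \<open>\<Theta>\<close>, so their difference vanishes there.\<close>
    have "((\<lambda>w. (?e x w - ?e x' w) * exp (\<eta> \<bullet> D w)) has_sum 0) (X B)" if "\<eta> \<in> \<Theta>" for \<eta>
    proof -
      have "((\<lambda>w. (if \<pi> B A w = x then exp (\<eta> \<bullet> D w) else 0) - (if \<pi> B A w = x' then exp (\<eta> \<bullet> D w) else 0))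
          has_sum (z B \<eta> / z A \<eta> - z B \<eta> / z A \<eta>)) (X B)"
        by (intro has_sum_diff fibre_sum that x x')
      moreover have "(\<lambda>w. (?e x w - ?e x' w) * exp (\<eta> \<bullet> D w)) =
          (\<lambda>w. (if \<pi> B A w = x then exp (\<eta> \<bullet> D w) else 0) - (if \<pi> B A w = x' then exp (\<eta> \<bullet> D w) else 0))"
        by auto
      ultimately show ?thesis
        by simp
    qed
    then have "((\<lambda>w. ?e x w - ?e x' w) has_sum 0) {w \<in> X B. D w = \<delta>}"
      by (rule exponential_sum_uniqueness[OF countable_X[OF B] open_\<Theta> \<theta>])
    with has_sum_diff[OF multiplicity[of x \<delta>] multiplicity[of x' \<delta>]]
    have "z B \<theta> * exp (- (\<theta> \<bullet> \<delta>)) * exp (- (\<theta> \<bullet> t A x)) * ?p x -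
        z B \<theta> * exp (- (\<theta> \<bullet> \<delta>)) * exp (- (\<theta> \<bullet> t A x')) * ?p x' = 0"
      by (rule has_sum_unique)
    then have "exp (- (\<theta> \<bullet> t A x)) * ?p x = exp (- (\<theta> \<bullet> t A x')) * ?p x'"
      using z_pos[OF B \<theta>] by simp
    then have "?p x * exp (\<theta> \<bullet> t A x') = ?p x' * exp (\<theta> \<bullet> t A x)"
      by (simp add: exp_minus field_simps)
    then show ?thesis
      using marginal[OF x \<theta>] marginal[OF x' \<theta>] z_pos[OF A \<theta>] by simp
  qed

  have \<pi>_measurable: "\<pi> B A \<in> measurable (P \<theta>) (count_space (X A))"
    and D_measurable: "D \<in> measurable (P \<theta>) (count_space (D ` X B))"
    using \<pi> by (auto simp: measurable_def)
  have "indep_var borel (id \<circ> D) borel (t A \<circ> \<pi> B A)"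
    using countable_X[OF A] countable_X[OF B] proportional
    by (intro indep_var_compose_if_product_law[OF \<pi>_measurable D_measurable]
        product_law_if_fibre_laws_proportional \<pi>_measurable D_measurable) auto
  then show "prob_space.indep_var (exp_distribution (X B) (t B) \<theta>)
      borel (\<lambda>w. t B w - t A (\<pi> B A w)) borel (\<lambda>w. t A (\<pi> B A w))"
    by (simp add: comp_def D_def P_def)
qed

end
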